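(* Let $\mathbb{F}$ be a field, $E=\mathbb{F}^n$ with a fixed nondegenerate bilinear form, and let $\Delta=(E,\mathcal{F})$ be a $q$-$\Delta$-matroid. Let $\mathcal{F}^*=\{F^\perp : F\in\mathcal{F}\}$. Then $\Delta^*=(E,\mathcal{F}^* )$ is also a $q$-$\Delta$-matroid.
   Context: $E=\mathbb{F}^n$ is a finite-dimensional vector space over a field $\mathbb{F}$, and $W^\perp$ denotes the orthogonal complement of a subspace $W\subseteq E$ with respect to the fixed nondegenerate bilinear form. A $q$-$\Delta$-matroid is a pair $(E,\mathcal{F})$ with $\mathcal{F}$ a non-empty family of subspaces of $E$ satisfying: (F1) For all $X,Y\in\mathcal{F}$ and each subspace $A$ of codimension $1$ in $X$, either (i) there is a codimension-$1$ subspace $Z\subseteq E$ with $A\subseteq Z$, $Y\not\subseteq Z$, such that $A+z\in\mathcal{F}$ for all $1$-dimensional $z\subseteq E$ with $z\not\subseteq Z$; or (ii) there is a codimension-$1$ subspace $Z\subseteq E$ such that $Z\cap A\in\mathcal{F}$. (F2) For all $X,Y\in\mathcal{F}$ and each subspace $A\subseteq E$ in which $X$ has codimension $1$, either (iii) there is a $1$-dimensional $z\subseteq A$, $z\not\subseteq Y$, such that $A\cap Z\in\mathcal{F}$ for every codimension-$1$ subspace $Z\subseteq E$ with $z\not\subseteq Z$; or (iv) there is a $1$-dimensional $z\subseteq E$ such that $A+z\in\mathcal{F}$. *)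

theory Defs
  imports Complex_Main "HOL-Library.Set_Algebras"
begin

text \<open>
  The ground space \<open>E\<close> is the universe of a type carrying the structure of a finite-dimensional
  vector space over the field \<open>'a\<close>; every space \<open>'a ^ 'n\<close>, as well as the zero space, is of this
  form.  The sum \<open>A + z\<close> of subspaces is the elementwise sum of sets.
\<close>

context finite_dimensional_vector_space
begin

definition codim_one_in :: "'b set \<Rightarrow> 'b set \<Rightarrow> bool" where
  "codim_one_in A X \<longleftrightarrow> subspace A \<and> subspace X \<and> A \<subseteq> X \<and> dim X = dim A + 1"

definition hyperplane :: "'b set \<Rightarrow> bool" where
  "hyperplane Z \<longleftrightarrow> codim_one_in Z UNIV"

definition line :: "'b set \<Rightarrow> bool" where
  "line z \<longleftrightarrow> subspace z \<and> dim z = 1"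

definition F1 :: "'b set set \<Rightarrow> bool" where
  "F1 \<F> \<longleftrightarrow> (\<forall>X\<in>\<F>. \<forall>Y\<in>\<F>. \<forall>A. codim_one_in A X \<longrightarrow>
     (\<exists>Z. hyperplane Z \<and> A \<subseteq> Z \<and> \<not> Y \<subseteq> Z \<and> (\<forall>z. line z \<and> \<not> z \<subseteq> Z \<longrightarrow> A + z \<in> \<F>)) \<or>
     (\<exists>Z. hyperplane Z \<and> Z \<inter> A \<in> \<F>))"

definition F2 :: "'b set set \<Rightarrow> bool" where
  "F2 \<F> \<longleftrightarrow> (\<forall>X\<in>\<F>. \<forall>Y\<in>\<F>. \<forall>A. codim_one_in X A \<longrightarrow>
     (\<exists>z. line z \<and> z \<subseteq> A \<and> \<not> z \<subseteq> Y \<and> (\<forall>Z. hyperplane Z \<and> \<not> z \<subseteq> Z \<longrightarrow> A \<inter> Z \<in> \<F>)) \<or>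
     (\<exists>z. line z \<and> A + z \<in> \<F>))"

definition q_delta_matroid :: "'b set set \<Rightarrow> bool" where
  "q_delta_matroid \<F> \<longleftrightarrow> \<F> \<noteq> {} \<and> (\<forall>X\<in>\<F>. subspace X) \<and> F1 \<F> \<and> F2 \<F>"

definition bilinear_form :: "('b \<Rightarrow> 'b \<Rightarrow> 'a) \<Rightarrow> bool" where
  "bilinear_form B \<longleftrightarrow>
     (\<forall>x. Vector_Spaces.linear scale (*) (\<lambda>y. B x y)) \<and>
     (\<forall>y. Vector_Spaces.linear scale (*) (\<lambda>x. B x y))"

definition nondegenerate :: "('b \<Rightarrow> 'b \<Rightarrow> 'a) \<Rightarrow> bool" where
  "nondegenerate B \<longleftrightarrow>
     (\<forall>x. (\<forall>y. B x y = 0) \<longrightarrow> x = 0) \<and> (\<forall>y. (\<forall>x. B x y = 0) \<longrightarrow> y = 0)"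

end

text \<open>
  The form need not be symmetric.  The complement taken here is the right one; the left one is the
  right complement for the flipped form \<open>\<lambda>x y. B y x\<close>.
\<close>

definition perp :: "('b \<Rightarrow> 'b \<Rightarrow> 'a::zero) \<Rightarrow> 'b set \<Rightarrow> 'b set" where
  "perp B W = {v. \<forall>w\<in>W. B w v = 0}"

definition dual_family :: "('b \<Rightarrow> 'b \<Rightarrow> 'a::zero) \<Rightarrow> 'b set set \<Rightarrow> 'b set set" where
  "dual_family B \<F> = {perp B X | X. X \<in> \<F>}"

end

theory Submission imports Defs begin

text \<open>
  Taking the complement \<open>W \<mapsto> W\<^sup>\<bottom>\<close> is an inclusion-reversing bijection on subspaces, inverse to
  the complement on the other side; it exchanges sums with intersections and lines with
  hyperplanes.  Under it (F1) for the dual family is exactly (F2) for the original one, with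
  (i), (ii) coming from (iii), (iv), and vice versa.
\<close>

locale nondegenerate_form = finite_dimensional_vector_space scale Basis
  for scale :: "'a::field \<Rightarrow> 'b::ab_group_add \<Rightarrow> 'b" and Basis :: "'b set" +
  fixes B :: "'b \<Rightarrow> 'b \<Rightarrow> 'a"
  assumes bilinear: "bilinear_form B"
    and nondegenerate: "nondegenerate B"
begin

section \<open>Bilinearity and elementary properties of complements\<close>

lemma linear_right: "Vector_Spaces.linear scale (*) (\<lambda>y. B x y)"
  and linear_left: "Vector_Spaces.linear scale (*) (\<lambda>x. B x y)"
  using bilinear by (simp_all add: bilinear_form_def)

lemmas form_simps =
  module_hom.zero[OF Vector_Spaces.linear.axioms(3)[OF linear_right]]
  module_hom.zero[OF Vector_Spaces.linear.axioms(3)[OF linear_left]]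
  module_hom.add[OF Vector_Spaces.linear.axioms(3)[OF linear_right]]
  module_hom.add[OF Vector_Spaces.linear.axioms(3)[OF linear_left]]
  module_hom.scale[OF Vector_Spaces.linear.axioms(3)[OF linear_right]]
  module_hom.scale[OF Vector_Spaces.linear.axioms(3)[OF linear_left]]
  module_hom.diff[OF Vector_Spaces.linear.axioms(3)[OF linear_right]]

text \<open>Both hypotheses on the form are symmetric in its two arguments. Interpreting the locale
  for the flipped form turns every fact about right complements into one about left
  complements.\<close>

lemma nondegenerate_form_flip: "nondegenerate_form scale Basis (\<lambda>x y. B y x)"
  using bilinear nondegenerate
  by unfold_locales (auto simp: bilinear_form_def nondegenerate_def)

lemma subspace_perp: "subspace (perp B W)"
  by (auto simp: perp_def form_simps intro!: subspaceI)

lemma perp_antimono: "V \<subseteq> W \<Longrightarrow> perp B W \<subseteq> perp B V"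
  by (auto simp: perp_def)

text \<open>For a fixed \<open>v\<close>, the vectors \<open>x\<close> with \<open>B x v = 0\<close>
  form a subspace, so this subspace contains \<open>span S\<close> as soon as it contains
  \<open>S\<close>.\<close>

lemma perp_span: "perp B (span S) = perp B S"
proof
  show "perp B (span S) \<subseteq> perp B S"
    by (intro perp_antimono span_superset)
  have "span S \<subseteq> {x. B x v = 0}" if "v \<in> perp B S" for v
    using that by (intro span_minimal subspaceI) (auto simp: perp_def form_simps)
  then show "perp B S \<subseteq> perp B (span S)"
    by (auto simp: perp_def)
qed

section \<open>Dimension of the complement\<close>

text \<open>The intersection is the kernel of the functional \<open>B x\<close> on \<open>W\<close>,
  and the kernel of a single functional has codimension at most one.\<close>

lemma dim_le_perp_singleton:
  assumes "subspace W"
  shows "dim W \<le> dim (W \<inter> perp B {x}) + 1"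
proof (cases "W \<subseteq> perp B {x}")
  case True
  then show ?thesis by (simp add: Int_absorb2)
next
  case False
  then obtain w where w: "w \<in> W" "B x w \<noteq> 0"
    by (auto simp: perp_def)
  have "v \<in> span (insert w (W \<inter> perp B {x}))" if "v \<in> W" for v
  proof -
    \<comment> \<open>Subtracting the multiple of \<open>w\<close> on which \<open>B x\<close> takes
      the same value as on \<open>v\<close> lands in the kernel, so \<open>w\<close> and the kernel
      together span \<open>W\<close>.\<close>
    have "v - scale (B x v / B x w) w \<in> W \<inter> perp B {x}"
      using that w assms
      by (auto simp: perp_def form_simps intro!: subspace_diff subspace_scale)
    then show ?thesis
      unfolding span_insert by (auto intro!: span_base)
  qed
  then have "dim W \<le> dim (insert w (W \<inter> perp B {x}))"
    by (intro dim_subset[of W "span _", unfolded dim_span]) auto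
  also have "\<dots> \<le> dim (W \<inter> perp B {x}) + 1"
    by (simp add: dim_insert)
  finally show ?thesis .
qed

lemma dim_perp_le_Un:
  assumes "finite T"
  shows "dim (perp B S) \<le> dim (perp B (S \<union> T)) + card T"
  using assms
proof (induction T)
  case (insert x T)
  have "perp B (S \<union> insert x T) = perp B (S \<union> T) \<inter> perp B {x}"
    by (auto simp: perp_def)
  then show ?case
    using insert dim_le_perp_singleton[OF subspace_perp, of "S \<union> T" x] by simp
qed simp

text \<open>
  Adding the elements of a basis of the whole space one by one lowers the dimension of the
  complement by at most one each, yet from \<open>dim UNIV\<close> down to zero; so each step lowers it
  by exactly one.
\<close>

lemma dim_perp:
  assumes "subspace W"
  shows "dim W + dim (perp B W) = dim UNIV"
proof -
  obtain S where S: "S \<subseteq> W" "independent S" "span S = W"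
    by (metis assms basis_exists span_subspace)
  define C where "C = extend_basis S"
  have C: "S \<subseteq> C" "independent C" "span C = UNIV"
    using S(2) by (simp_all add: C_def extend_basis_superset independent_extend_basis)
  have fin: "finite C" "finite S"
    using S C finiteI_independent by blast+
  have card: "card S = dim W" "card C = dim UNIV"
    using dim_span_eq_card_independent[OF S(2)] dim_span_eq_card_independent[OF C(2)] S(3) C(3)
    by simp_all
  have perp_S: "perp B S = perp B W"
    using perp_span[of S] S(3) by simp
  have perp_C: "dim (perp B C) = 0"
    unfolding perp_span[of C, symmetric] C(3)
    using nondegenerate by (auto simp: perp_def nondegenerate_def)
  \<comment> \<open>\<open>perp B {}\<close> is the whole space, so passing from the empty set to
    \<open>S\<close> bounds \<open>dim (perp B W)\<close> from below. Passing on from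
    \<open>S\<close> to \<open>C\<close>, whose complement is zero, bounds it from above.\<close>
  have "dim (perp B {}) \<le> dim (perp B ({} \<union> S)) + card S"
    by (rule dim_perp_le_Un[OF fin(2)])
  then have lower: "dim UNIV \<le> dim (perp B W) + dim W"
    by (simp add: perp_S card) (simp add: perp_def)
  have "dim (perp B S) \<le> dim (perp B (S \<union> (C - S))) + card (C - S)"
    using fin by (intro dim_perp_le_Un) simp
  then have "dim (perp B W) \<le> card (C - S)"
    using C(1) perp_C by (simp add: perp_S Un_absorb1)
  then have "dim (perp B W) + dim W \<le> dim UNIV"
    using card_Diff_subset[OF fin(2) C(1)] card_mono[OF fin(1) C(1)] card by simp
  with lower show ?thesis by simp
qed

section \<open>Complements as an anti-isomorphism of subspaces\<close>

text \<open>One inclusion is immediate, and \<open>dim_perp\<close> for the form and for its flip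
  makes the dimensions agree. The inner complement is the left one because the form may fail to be
  symmetric.\<close>

lemma double_perp:
  assumes "subspace W"
  shows "perp B (perp (\<lambda>x y. B y x) W) = W"
proof -
  interpret flip: nondegenerate_form scale Basis "\<lambda>x y. B y x"
    by (rule nondegenerate_form_flip)
  let ?V = "perp (\<lambda>x y. B y x) W"
  have "dim (perp B ?V) = dim W"
    using flip.dim_perp[OF assms] dim_perp[OF flip.subspace_perp[of W]] by simp
  moreover have "W \<subseteq> perp B ?V"
    by (auto simp: perp_def)
  ultimately show ?thesis
    using subspace_dim_equal[OF assms subspace_perp, of ?V] by simp
qed

lemma perp_subset_iff:
  assumes "subspace V" "subspace W"
  shows "perp B V \<subseteq> perp B W \<longleftrightarrow> W \<subseteq> V"
proof -
  interpret flip: nondegenerate_form scale Basis "\<lambda>x y. B y x"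
    by (rule nondegenerate_form_flip)
  show ?thesis
    using flip.double_perp[OF assms(1)] flip.double_perp[OF assms(2)]
    by (metis flip.perp_antimono perp_antimono)
qed

lemma subspace_set_plus: "subspace V \<Longrightarrow> subspace W \<Longrightarrow> subspace (V + W)"
  using subspace_sums[of V W] by (simp add: set_plus_def Bex_def conj_ac)

lemma perp_set_plus:
  assumes "subspace V" "subspace W"
  shows "perp B (V + W) = perp B V \<inter> perp B W"
proof
  have "V \<subseteq> V + W" "W \<subseteq> V + W"
    using assms set_zero_plus2[of W V] set_zero_plus2[of V W]
    by (auto simp: subspace_0 add.commute)
  then show "perp B (V + W) \<subseteq> perp B V \<inter> perp B W"
    by (simp add: perp_antimono)
  show "perp B V \<inter> perp B W \<subseteq> perp B (V + W)"
    by (auto simp: perp_def set_plus_def form_simps)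
qed

text \<open>This is the rule for sums, read for the flipped form at the subspaces
  \<open>perp B V\<close> and \<open>perp B W\<close>, and then carried back by
  \<open>double_perp\<close>.\<close>

lemma perp_Int:
  assumes "subspace V" "subspace W"
  shows "perp B (V \<inter> W) = perp B V + perp B W"
proof -
  interpret flip: nondegenerate_form scale Basis "\<lambda>x y. B y x"
    by (rule nondegenerate_form_flip)
  have "V \<inter> W = perp (\<lambda>x y. B y x) (perp B V + perp B W)"
    using assms by (simp add: flip.perp_set_plus subspace_perp flip.double_perp)
  then show ?thesis
    by (simp add: double_perp subspace_set_plus subspace_perp)
qed

lemma codim_one_in_perp:
  assumes "codim_one_in V W"
  shows "codim_one_in (perp B W) (perp B V)"
  using assms dim_perp[of V] dim_perp[of W]
  by (auto simp: codim_one_in_def subspace_perp perp_antimono[THEN subsetD])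

lemma hyperplane_perp: "line z \<Longrightarrow> hyperplane (perp B z)"
  using dim_perp[of z] by (simp add: line_def hyperplane_def codim_one_in_def subspace_perp)

lemma line_perp: "hyperplane Z \<Longrightarrow> line (perp B Z)"
  using dim_perp[of Z] by (simp add: line_def hyperplane_def codim_one_in_def subspace_perp)

section \<open>Exchange of the two axioms\<close>

lemma F1_dual_family:
  assumes sub: "\<forall>X\<in>\<F>. subspace X" and F2: "F2 \<F>"
  shows "F1 (dual_family B \<F>)"
  unfolding F1_def
proof (intro ballI allI impI)
  fix X' Y' A'
  assume "X' \<in> dual_family B \<F>" "Y' \<in> dual_family B \<F>" and A': "codim_one_in A' X'"
  then obtain X Y where X: "X \<in> \<F>" "X' = perp B X" and Y: "Y \<in> \<F>" "Y' = perp B Y"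
    by (auto simp: dual_family_def)
  interpret flip: nondegenerate_form scale Basis "\<lambda>x y. B y x"
    by (rule nondegenerate_form_flip)
  \<comment> \<open>The left complement undoes \<open>perp B\<close>: it sends \<open>X'\<close>
    back to \<open>X\<close> and reverses inclusions, so \<open>A\<close> contains \<open>X\<close>
    with codimension one, as (F2) requires.\<close>
  define A where "A = perp (\<lambda>x y. B y x) A'"
  have subA: "subspace A"
    by (simp add: A_def flip.subspace_perp)
  have perp_A: "perp B A = A'"
    using A' by (simp add: A_def double_perp codim_one_in_def)
  have "codim_one_in X A"
    using flip.codim_one_in_perp[OF A'] sub X by (simp add: A_def flip.double_perp)
  then consider
      (iii) z where "line z" "z \<subseteq> A" "\<not> z \<subseteq> Y" "\<forall>Z. hyperplane Z \<and> \<not> z \<subseteq> Z \<longrightarrow> A \<inter> Z \<in> \<F>"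
    | (iv) z where "line z" "A + z \<in> \<F>"
    using F2 X(1) Y(1) unfolding F2_def by meson
  then show "(\<exists>Z. hyperplane Z \<and> A' \<subseteq> Z \<and> \<not> Y' \<subseteq> Z \<and>
      (\<forall>z. line z \<and> \<not> z \<subseteq> Z \<longrightarrow> A' + z \<in> dual_family B \<F>)) \<or>
    (\<exists>Z. hyperplane Z \<and> Z \<inter> A' \<in> dual_family B \<F>)"
  proof cases
    case iii
    have subz: "subspace z" using iii(1) by (simp add: line_def)
    \<comment> \<open>The hyperplane required in (i) is \<open>perp B z\<close>. A line
      \<open>y\<close> outside it is the complement of a hyperplane \<open>?Z\<close> that misses
      \<open>z\<close>, and (iii) applies to \<open>?Z\<close>.\<close>
    have "A' + y \<in> dual_family B \<F>" if y: "line y" "\<not> y \<subseteq> perp B z" for y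
    proof -
      let ?Z = "perp (\<lambda>x y. B y x) y"
      have perp_Z: "perp B ?Z = y"
        using y(1) by (simp add: double_perp line_def)
      have "\<not> z \<subseteq> ?Z"
        using y(2) perp_subset_iff[OF flip.subspace_perp subz, of y] perp_Z by simp
      then have "A \<inter> ?Z \<in> \<F>"
        using iii(4) flip.hyperplane_perp[OF y(1)] by simp
      moreover have "A' + y = perp B (A \<inter> ?Z)"
        by (simp add: perp_Int subA flip.subspace_perp perp_A perp_Z)
      ultimately show ?thesis by (auto simp: dual_family_def)
    qed
    moreover have "A' \<subseteq> perp B z"
      using perp_antimono[OF iii(2)] perp_A by simp
    moreover have "\<not> Y' \<subseteq> perp B z"
      using perp_subset_iff[OF _ subz, of Y] iii(3) sub Y by simp
    ultimately show ?thesis using hyperplane_perp[OF iii(1)] by blast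
  next
    \<comment> \<open>Here too \<open>perp B z\<close> is the witness, since complements turn the
      sum \<open>A + z\<close> into an intersection.\<close>
    case iv
    have "perp B z \<inter> A' = perp B (A + z)"
      using iv(1) by (simp add: perp_set_plus subA line_def perp_A Int_commute)
    then have "perp B z \<inter> A' \<in> dual_family B \<F>"
      using iv(2) by (auto simp: dual_family_def)
    then show ?thesis
      using hyperplane_perp[OF iv(1)] by blast
  qed
qed

lemma F2_dual_family:
  assumes sub: "\<forall>X\<in>\<F>. subspace X" and F1: "F1 \<F>"
  shows "F2 (dual_family B \<F>)"
  unfolding F2_def
proof (intro ballI allI impI)
  fix X' Y' A'
  assume "X' \<in> dual_family B \<F>" "Y' \<in> dual_family B \<F>" and A': "codim_one_in X' A'"
  then obtain X Y where X: "X \<in> \<F>" "X' = perp B X" and Y: "Y \<in> \<F>" "Y' = perp B Y"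
    by (auto simp: dual_family_def)
  interpret flip: nondegenerate_form scale Basis "\<lambda>x y. B y x"
    by (rule nondegenerate_form_flip)
  define A where "A = perp (\<lambda>x y. B y x) A'"
  have subA: "subspace A"
    by (simp add: A_def flip.subspace_perp)
  have perp_A: "perp B A = A'"
    using A' by (simp add: A_def double_perp codim_one_in_def)
  \<comment> \<open>Now \<open>X'\<close> lies in \<open>A'\<close>, so the pullback reverses the
    roles: \<open>A\<close> lies in \<open>X\<close>, and (F1) applies.\<close>
  have "codim_one_in A X"
    using flip.codim_one_in_perp[OF A'] sub X by (simp add: A_def flip.double_perp)
  then consider
      (i) Z where "hyperplane Z" "A \<subseteq> Z" "\<not> Y \<subseteq> Z" "\<forall>z. line z \<and> \<not> z \<subseteq> Z \<longrightarrow> A + z \<in> \<F>"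
    | (ii) Z where "hyperplane Z" "Z \<inter> A \<in> \<F>"
    using F1 X(1) Y(1) unfolding F1_def by meson
  then show "(\<exists>z. line z \<and> z \<subseteq> A' \<and> \<not> z \<subseteq> Y' \<and>
      (\<forall>Z. hyperplane Z \<and> \<not> z \<subseteq> Z \<longrightarrow> A' \<inter> Z \<in> dual_family B \<F>)) \<or>
    (\<exists>z. line z \<and> A' + z \<in> dual_family B \<F>)"
  proof cases
    case i
    have subZ: "subspace Z" using i(1) by (simp add: hyperplane_def codim_one_in_def)
    \<comment> \<open>The line required in (iii) is \<open>perp B Z\<close>. A hyperplane
      \<open>H\<close> not containing it has as left complement a line \<open>?z\<close> outside
      \<open>Z\<close>, and (i) applies to \<open>?z\<close>.\<close>
    have "A' \<inter> H \<in> dual_family B \<F>" if H: "hyperplane H" "\<not> perp B Z \<subseteq> H" for H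
    proof -
      let ?z = "perp (\<lambda>x y. B y x) H"
      have perp_z: "perp B ?z = H"
        using H(1) by (simp add: double_perp hyperplane_def codim_one_in_def)
      have "\<not> ?z \<subseteq> Z"
        using H(2) perp_antimono[of ?z Z] perp_z by auto
      then have "A + ?z \<in> \<F>"
        using i(4) flip.line_perp[OF H(1)] by simp
      moreover have "A' \<inter> H = perp B (A + ?z)"
        by (simp add: perp_set_plus subA flip.subspace_perp perp_A perp_z)
      ultimately show ?thesis by (auto simp: dual_family_def)
    qed
    moreover have "perp B Z \<subseteq> A'"
      using perp_antimono[OF i(2)] perp_A by simp
    moreover have "\<not> perp B Z \<subseteq> Y'"
      using perp_subset_iff[OF subZ, of Y] i(3) sub Y by simp
    ultimately show ?thesis using line_perp[OF i(1)] by blast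
  next
    case ii
    have "A' + perp B Z = perp B (Z \<inter> A)"
      using ii(1)
      by (simp add: perp_Int subA hyperplane_def codim_one_in_def perp_A add.commute)
    then have "A' + perp B Z \<in> dual_family B \<F>"
      using ii(2) by (auto simp: dual_family_def)
    then show ?thesis
      using line_perp[OF ii(1)] by blast
  qed
qed

end

theorem proposition3p2:
  fixes scale :: "'a::field \<Rightarrow> 'b::ab_group_add \<Rightarrow> 'b"
    and Basis :: "'b set"
    and B :: "'b \<Rightarrow> 'b \<Rightarrow> 'a"
    and \<F> :: "'b set set"
  assumes "finite_dimensional_vector_space scale Basis"
    and "finite_dimensional_vector_space.bilinear_form scale B"
    and "finite_dimensional_vector_space.nondegenerate B"
    and "finite_dimensional_vector_space.q_delta_matroid scale \<F>"
  shows "finite_dimensional_vector_space.q_delta_matroid scale (dual_family B \<F>)"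
proof -
  interpret nondegenerate_form scale Basis B
    using assms(1-3) by (simp add: nondegenerate_form_def nondegenerate_form_axioms_def)
  have "\<F> \<noteq> {}" "\<forall>X\<in>\<F>. subspace X" "F1 \<F>" "F2 \<F>"
    using assms(4) by (simp_all add: q_delta_matroid_def)
  then show ?thesis
    using F1_dual_family F2_dual_family subspace_perp
    by (auto simp: q_delta_matroid_def dual_family_def)
qed

end
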